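(* Let $C_n$ denote the cycle of order $n$. (1) For every integer $n\ge 4$, $D_{\max}(C_n)=D'_{\max}(C_n)=2$. (2) $\chi_{D,\max}(C_4)=4$ and, for every integer $n\ge 5$, $\chi_{D,\max}(C_n)=3$. (3) For every integer $n\ge 4$, $\chi'_{D,\max}(C_n)=3$.
   Context: An orientation of a simple graph assigns one direction to each edge. An automorphism of an oriented graph is a permutation $\phi$ of its vertices such that $\phi(u)\phi(v)$ is an arc whenever $uv$ is an arc. An $r$-vertex-labelling maps vertices to $\{1,\dots,r\}$, an $r$-arc-labelling maps arcs to $\{1,\dots,r\}$; colourings are proper labellings (adjacent vertices, resp. arcs sharing an end-vertex, get distinct labels). A labelling $\lambda$ is distinguishing if the only automorphism $\phi$ with $\lambda(\phi(u))=\lambda(u)$ for all vertices (resp. $\lambda(\phi(u)\phi(v))=\lambda(uv)$ for all arcs) is the identity. For an oriented graph $\vec G$, $D(\vec G)$, $\chi_D(\vec G)$, $D'(\vec G)$, $\chi'_D(\vec G)$ are the least $r$ for which $\vec G$ admits a distinguishing $r$-vertex-labelling, $r$-vertex-colouring, $r$-arc-labelling, $r$-arc-colouring. For an undirected graph $G$, $D_{\max}(G)$, $\chi_{D,\max}(G)$, $D'_{\max}(G)$, $\chi'_{D,\max}(G)$ are the maxima of these respective parameters over all orientations of $G$. *)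

theory Defs
  imports "HOL-Library.FuncSet" "HOL-Combinatorics.Permutations"
begin

type_synonym 'a ugraph = "'a set \<times> 'a set set"
type_synonym 'a ograph = "'a set \<times> ('a \<times> 'a) set"

definition simple_graph :: "'a ugraph \<Rightarrow> bool" where
  "simple_graph = (\<lambda>(V, E). finite V \<and> (\<forall>e\<in>E. e \<subseteq> V \<and> card e = 2))"

definition ends :: "'a \<times> 'a \<Rightarrow> 'a set" where
  "ends a = {fst a, snd a}"

definition orientations :: "'a ugraph \<Rightarrow> 'a ograph set" where
  "orientations = (\<lambda>(V, E). {(V, A) | A.
     (\<forall>a\<in>A. ends a \<in> E) \<and> (\<forall>e\<in>E. \<exists>!a. a \<in> A \<and> ends a = e)})"

text \<open>\<^term>\<open>\<phi> permutes V\<close> makes \<^term>\<open>\<phi>\<close> the identity outside \<^term>\<open>V\<close>, so the identity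
  automorphism is exactly \<^const>\<open>id\<close>.\<close>

definition automorphism :: "'a ograph \<Rightarrow> ('a \<Rightarrow> 'a) \<Rightarrow> bool" where
  "automorphism = (\<lambda>(V, A) \<phi>. \<phi> permutes V \<and> (\<forall>u v. (u, v) \<in> A \<longrightarrow> (\<phi> u, \<phi> v) \<in> A))"

definition vertex_labelling :: "'a ograph \<Rightarrow> nat \<Rightarrow> ('a \<Rightarrow> nat) \<Rightarrow> bool" where
  "vertex_labelling = (\<lambda>(V, A) r l. l \<in> V \<rightarrow> {1..r})"

definition arc_labelling :: "'a ograph \<Rightarrow> nat \<Rightarrow> ('a \<times> 'a \<Rightarrow> nat) \<Rightarrow> bool" where
  "arc_labelling = (\<lambda>(V, A) r l. l \<in> A \<rightarrow> {1..r})"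

definition vertex_colouring :: "'a ograph \<Rightarrow> nat \<Rightarrow> ('a \<Rightarrow> nat) \<Rightarrow> bool" where
  "vertex_colouring = (\<lambda>(V, A) r l. vertex_labelling (V, A) r l \<and>
     (\<forall>u v. (u, v) \<in> A \<longrightarrow> l u \<noteq> l v))"

definition arc_colouring :: "'a ograph \<Rightarrow> nat \<Rightarrow> ('a \<times> 'a \<Rightarrow> nat) \<Rightarrow> bool" where
  "arc_colouring = (\<lambda>(V, A) r l. arc_labelling (V, A) r l \<and>
     (\<forall>a\<in>A. \<forall>b\<in>A. a \<noteq> b \<and> ends a \<inter> ends b \<noteq> {} \<longrightarrow> l a \<noteq> l b))"

definition vertex_distinguishing :: "'a ograph \<Rightarrow> ('a \<Rightarrow> nat) \<Rightarrow> bool" where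
  "vertex_distinguishing = (\<lambda>(V, A) l.
     \<forall>\<phi>. automorphism (V, A) \<phi> \<and> (\<forall>u\<in>V. l (\<phi> u) = l u) \<longrightarrow> \<phi> = id)"

definition arc_distinguishing :: "'a ograph \<Rightarrow> ('a \<times> 'a \<Rightarrow> nat) \<Rightarrow> bool" where
  "arc_distinguishing = (\<lambda>(V, A) l.
     \<forall>\<phi>. automorphism (V, A) \<phi> \<and> (\<forall>u v. (u, v) \<in> A \<longrightarrow> l (\<phi> u, \<phi> v) = l (u, v)) \<longrightarrow> \<phi> = id)"

text \<open>The two arc parameters are unspecified for an oriented graph that has no distinguishing
  arc labelling at all (one with a nontrivial automorphism fixing every arc, such as two isolated
  vertices).  Every orientation of a cycle of order at least 3 has one, for instance any injective
  labelling.\<close>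

definition dist_number :: "'a ograph \<Rightarrow> nat" where
  "dist_number G = (LEAST r. \<exists>l. vertex_labelling G r l \<and> vertex_distinguishing G l)"

definition dist_chromatic_number :: "'a ograph \<Rightarrow> nat" where
  "dist_chromatic_number G = (LEAST r. \<exists>l. vertex_colouring G r l \<and> vertex_distinguishing G l)"

definition dist_index :: "'a ograph \<Rightarrow> nat" where
  "dist_index G = (LEAST r. \<exists>l. arc_labelling G r l \<and> arc_distinguishing G l)"

definition dist_chromatic_index :: "'a ograph \<Rightarrow> nat" where
  "dist_chromatic_index G = (LEAST r. \<exists>l. arc_colouring G r l \<and> arc_distinguishing G l)"

text \<open>For a \<^const>\<open>simple_graph\<close> the set of orientations is finite and nonempty, so each
  \<^const>\<open>Max\<close> below is a genuine maximum.\<close>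

definition D_max :: "'a ugraph \<Rightarrow> nat" where
  "D_max G = Max (dist_number ` orientations G)"

definition chi_D_max :: "'a ugraph \<Rightarrow> nat" where
  "chi_D_max G = Max (dist_chromatic_number ` orientations G)"

definition D'_max :: "'a ugraph \<Rightarrow> nat" where
  "D'_max G = Max (dist_index ` orientations G)"

definition chi'_D_max :: "'a ugraph \<Rightarrow> nat" where
  "chi'_D_max G = Max (dist_chromatic_index ` orientations G)"

definition cycle_graph :: "nat \<Rightarrow> nat ugraph" where
  "cycle_graph n = ({0..<n}, {{i, Suc i mod n} | i. i < n})"

lemma simple_graph_cycle_graph:
  assumes "n \<ge> 3"
  shows "simple_graph (cycle_graph n)"
proof -
  have "card {i, Suc i mod n} = 2" if "i < n" for i
    using that assms by (cases "Suc i = n") auto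
  then show ?thesis
    using assms by (auto simp: simple_graph_def cycle_graph_def)
qed

lemma finite_orientations:
  assumes "simple_graph G"
  shows "finite (orientations G)"
proof -
  obtain V E where G: "G = (V, E)" by (cases G)
  have "A \<subseteq> V \<times> V" if "(V, A) \<in> orientations G" for A
  proof
    fix a assume "a \<in> A"
    with that have "ends a \<in> E" by (auto simp: G orientations_def)
    with assms have "ends a \<subseteq> V" by (auto simp: G simple_graph_def)
    then show "a \<in> V \<times> V" by (cases a) (auto simp: ends_def)
  qed
  then have "orientations G \<subseteq> Pair V ` Pow (V \<times> V)"
    unfolding G by (auto simp: orientations_def)
  moreover have "finite (Pair V ` Pow (V \<times> V))"
    using assms by (auto simp: G simple_graph_def)
  ultimately show ?thesis by (rule finite_subset)
qed

lemma orientations_nonempty: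
  assumes "simple_graph G"
  shows "orientations G \<noteq> {}"
proof -
  obtain V E where G: "G = (V, E)" by (cases G)
  have "\<forall>e\<in>E. \<exists>a. ends a = e"
    using assms by (fastforce simp: G simple_graph_def ends_def card_2_iff)
  then obtain f where f: "\<And>e. e \<in> E \<Longrightarrow> ends (f e) = e" by metis
  have "(V, f ` E) \<in> orientations G"
    unfolding G orientations_def by (auto simp: f) (metis f prod.inject)+
  then show ?thesis by blast
qed

end

theory Submission imports Defs
begin

text \<open>An automorphism of an oriented cycle that fixes two adjacent vertices is the identity, and no
  automorphism reverses an edge.  So it suffices to mark a single edge, by giving its ends or its
  arc a label used nowhere else; this also works for proper arc colourings, by alternating two
  colours on the remaining path.  For proper vertex colourings, the alternating colouring with
  one vertex \<open>v\<close> recoloured \<open>3\<close> works whenever \<open>v\<close> is neither a source nor a sink, and also if \<open>n\<close>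
  is odd.  If \<open>n\<close> is even and every vertex is a source or a sink, the colouring
  \<open>3, 1, 2, 3, 1, 2, 1, 2, \<dots>\<close> works: the two vertices coloured \<open>3\<close> are a source and a sink.

  Conversely, a proper 2-colouring (of vertices or arcs) of the directed cycle is invariant under
  rotation by two steps.  For \<open>n = 4\<close>, exchanging two opposite vertices is an automorphism of the
  orientation in which sources and sinks alternate, so all four colours must differ.\<close>

section \<open>The successor map on the vertices of the cycle\<close>

definition nxt :: "nat \<Rightarrow> nat \<Rightarrow> nat" where
  "nxt n i = (if i < n then Suc i mod n else i)"

lemma nxt_eq: "i < n \<Longrightarrow> nxt n i = (if Suc i = n then 0 else Suc i)"
  by (auto simp: nxt_def)

lemma nxt_less: "i < n \<Longrightarrow> nxt n i < n"
  by (auto simp: nxt_def)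

lemma nxt_inj: "i < n \<Longrightarrow> j < n \<Longrightarrow> nxt n i = nxt n j \<longleftrightarrow> i = j"
  by (auto simp: nxt_eq split: if_splits)

lemma nxt_neq: "2 \<le> n \<Longrightarrow> i < n \<Longrightarrow> nxt n i \<noteq> i"
  by (auto simp: nxt_eq)

lemma nxt_nxt_neq: "3 \<le> n \<Longrightarrow> i < n \<Longrightarrow> nxt n (nxt n i) \<noteq> i"
  by (auto simp: nxt_eq nxt_less split: if_splits)

text \<open>An injective self-map of a finite set is onto; the identity branch of \<open>nxt\<close>
  outside the cycle is what \<open>permutes\<close> requires.\<close>

lemma nxt_permutes: "nxt n permutes {0..<n}"
proof (rule bij_imp_permutes)
  have "inj_on (nxt n) {0..<n}"
    by (auto simp: inj_on_def nxt_inj)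
  moreover have "nxt n ` {0..<n} \<subseteq> {0..<n}"
    by (auto simp: nxt_less)
  ultimately show "bij_betw (nxt n) {0..<n} {0..<n}"
    by (simp add: bij_betw_def endo_inj_surj)
qed (auto simp: nxt_def)

lemma edges_cycle_graph: "cycle_graph n = ({0..<n}, {{i, nxt n i} | i. i < n})"
  by (auto simp: cycle_graph_def nxt_def)

lemma funpow_nxt_0: "j < n \<Longrightarrow> (nxt n ^^ j) 0 = j"
  by (induction j) (auto simp: nxt_eq)

section \<open>Arcs and neighbours in an arbitrary orientation\<close>

locale oriented_cycle =
  fixes n :: nat and A :: "(nat \<times> nat) set"
  assumes n_ge_3: "3 \<le> n"
    and orientation: "({0..<n}, A) \<in> orientations (cycle_graph n)"
begin

lemma arc_cases:
  assumes "(u, v) \<in> A"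
  obtains "u < n" "v = nxt n u" | "v < n" "u = nxt n v"
proof -
  from orientation assms have "ends (u, v) \<in> {{i, nxt n i} | i. i < n}"
    by (auto simp: orientations_def edges_cycle_graph)
  then show ?thesis
    using that by (auto simp: ends_def doubleton_eq_iff)
qed

lemma arc_less: "(u, v) \<in> A \<Longrightarrow> u < n \<and> v < n"
  by (erule arc_cases) (simp_all add: nxt_less)

lemma unique_arc: "i < n \<Longrightarrow> \<exists>!a. a \<in> A \<and> ends a = {i, nxt n i}"
proof -
  assume "i < n"
  moreover have "\<forall>e\<in>{{i, nxt n i} | i. i < n}. \<exists>!a. a \<in> A \<and> ends a = e"
    using orientation unfolding orientations_def edges_cycle_graph by simp
  ultimately show ?thesis by (elim ballE) auto
qed

lemma edge_oriented: "i < n \<Longrightarrow> (i, nxt n i) \<in> A \<or> (nxt n i, i) \<in> A"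
proof -
  assume "i < n"
  then obtain a where "a \<in> A" "ends a = {i, nxt n i}"
    using unique_arc by blast
  then show ?thesis
    by (cases a) (auto simp: ends_def doubleton_eq_iff)
qed

lemma arc_asym:
  assumes "(u, v) \<in> A"
  shows "(v, u) \<notin> A"
proof
  assume vu: "(v, u) \<in> A"
  obtain i where i: "i < n" "{u, v} = {i, nxt n i}"
    using assms by (rule arc_cases) auto
  \<comment> \<open>For \<open>u = v\<close> the two pairs would coincide and not violate the
    uniqueness of the arc on an edge.\<close>
  then have "u \<noteq> v"
    using nxt_neq[of n i] n_ge_3 by (auto simp: doubleton_eq_iff)
  moreover have "ends (u, v) = {i, nxt n i}" "ends (v, u) = {i, nxt n i}"
    using i(2) by (auto simp: ends_def)
  ultimately show False
    using unique_arc[OF i(1)] assms vu by blast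
qed

text \<open>A vertex has only two neighbours: its successor and, \<open>nxt\<close> being injective,
  a single predecessor.\<close>

lemma neighbours:
  assumes "(u, v) \<in> A \<or> (v, u) \<in> A" "(u, w) \<in> A \<or> (w, u) \<in> A"
    "(u, x) \<in> A \<or> (x, u) \<in> A" "v \<noteq> w"
  shows "x = v \<or> x = w"
proof -
  have *: "x = nxt n u \<or> x < n \<and> u = nxt n x" if "(u, x) \<in> A \<or> (x, u) \<in> A" for x
    using that by (meson arc_cases)
  show ?thesis
    using *[OF assms(1)] *[OF assms(2)] *[OF assms(3)] assms(4)
    by (elim disjE conjE) (auto simp: nxt_inj)
qed

section \<open>Rigidity of automorphisms\<close>

context
  fixes \<phi> assumes aut: "automorphism ({0..<n}, A) \<phi>"
begin

lemma aut_arc: "(u, v) \<in> A \<Longrightarrow> (\<phi> u, \<phi> v) \<in> A"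
  using aut by (auto simp: automorphism_def)

lemma aut_permutes: "\<phi> permutes {0..<n}"
  using aut by (auto simp: automorphism_def)

lemma aut_eq_iff: "\<phi> u = \<phi> v \<longleftrightarrow> u = v"
  using aut_permutes by (metis permutes_inj injD)

lemma aut_edge:
  "(u, v) \<in> A \<or> (v, u) \<in> A \<Longrightarrow> (\<phi> u, \<phi> v) \<in> A \<or> (\<phi> v, \<phi> u) \<in> A"
  using aut_arc by blast

text \<open>Adjacency is preserved, so the image of the third vertex is a neighbour of the fixed
  middle one; the neighbour \<open>i\<close> is already taken, being its own image.\<close>

lemma fixed_step:
  assumes "i < n" "\<phi> i = i" "\<phi> (nxt n i) = nxt n i"
  shows "\<phi> (nxt n (nxt n i)) = nxt n (nxt n i)"
proof -
  let ?j = "nxt n i" and ?k = "nxt n (nxt n i)"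
  have "(?j, i) \<in> A \<or> (i, ?j) \<in> A" and jk: "(?j, ?k) \<in> A \<or> (?k, ?j) \<in> A"
    using edge_oriented[of i] edge_oriented[of ?j] assms(1) nxt_less by blast+
  moreover have "(?j, \<phi> ?k) \<in> A \<or> (\<phi> ?k, ?j) \<in> A"
    using aut_edge[OF jk] assms(3) by simp
  moreover have "i \<noteq> ?k"
    using nxt_nxt_neq[OF n_ge_3 assms(1)] by simp
  ultimately have "\<phi> ?k = i \<or> \<phi> ?k = ?k"
    using neighbours by blast
  then show ?thesis
    using \<open>i \<noteq> ?k\<close> assms(2) aut_eq_iff by metis
qed

lemma rigid_nxt:
  assumes "i < n" "\<phi> i = i" "\<phi> (nxt n i) = nxt n i"
  shows "\<phi> = id"
proof -
  have fixed: "\<phi> ((nxt n ^^ k) i) = (nxt n ^^ k) i \<and>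
      \<phi> (nxt n ((nxt n ^^ k) i)) = nxt n ((nxt n ^^ k) i) \<and> (nxt n ^^ k) i < n" for k
    by (induction k) (use assms fixed_step nxt_less in auto)
  \<comment> \<open>Passing through 0 reaches every vertex \<open>j\<close> from \<open>i\<close> in
    \<open>j + (n - i)\<close> steps, including those with \<open>j < i\<close>.\<close>
  have "(nxt n ^^ (n - i)) i = 0"
  proof -
    have "(nxt n ^^ (n - i)) i = (nxt n ^^ (n - i + i)) 0"
      unfolding funpow_add by (simp add: funpow_nxt_0[OF assms(1)])
    also have "n - i + i = Suc (n - 1)"
      using assms(1) by simp
    also have "(nxt n ^^ Suc (n - 1)) 0 = nxt n (n - 1)"
      using n_ge_3 funpow_nxt_0[of "n - 1" n] unfolding funpow.simps(2) comp_apply by simp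
    also have "\<dots> = 0"
      using n_ge_3 by (simp add: nxt_eq)
    finally show ?thesis .
  qed
  then have "\<phi> j = j" if "j < n" for j
    using fixed[of "j + (n - i)"] funpow_nxt_0[OF that] by (simp add: funpow_add)
  moreover have "\<phi> j = j" if "\<not> j < n" for j
    using permutes_not_in[OF aut_permutes] that by simp
  ultimately have "\<phi> j = id j" for j
    by (cases "j < n") simp_all
  then show ?thesis by (rule ext)
qed

lemma rigid:
  assumes "(u, v) \<in> A" "\<phi> u = u" "\<phi> v = v"
  shows "\<phi> = id"
  using assms(1) by (rule arc_cases) (use rigid_nxt assms in auto)

text \<open>With 0 fixed, 1 can only move to the other neighbour \<open>n - 1\<close> of 0.
  Colourings that separate 1 from \<open>n - 1\<close> rule out this reflection.\<close>

lemma rigid_0: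
  assumes "\<phi> 0 = 0" "\<phi> 1 \<noteq> n - 1"
  shows "\<phi> = id"
proof -
  have "nxt n 0 = 1" "nxt n (n - 1) = 0"
    using n_ge_3 by (auto simp: nxt_eq)
  then have 01: "(0, 1) \<in> A \<or> (1, 0) \<in> A" and "(0, n - 1) \<in> A \<or> (n - 1, 0) \<in> A"
    using edge_oriented[of 0] edge_oriented[of "n - 1"] n_ge_3 by auto
  moreover have "(0, \<phi> 1) \<in> A \<or> (\<phi> 1, 0) \<in> A"
    using aut_edge[OF 01] assms(1) by simp
  moreover have "1 \<noteq> n - 1" using n_ge_3 by simp
  ultimately have "\<phi> 1 = 1"
    using neighbours assms(2) by blast
  then show ?thesis
    using rigid 01 assms(1) by blast
qed

text \<open>The directions of the arcs matter here: a swap would map the arc on this edge to its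
  reverse, against \<open>arc_asym\<close>.\<close>

lemma not_swap:
  assumes "u < n" "\<phi> u = nxt n u" "\<phi> (nxt n u) = u"
  shows False
  using edge_oriented[OF assms(1)] aut_arc[of u "nxt n u"] aut_arc[of "nxt n u" u]
    arc_asym assms(2,3) by auto

end

section \<open>Upper bounds: labellings with two labels and arc colourings\<close>

lemma vertex_labelling_2:
  "\<exists>l. vertex_labelling ({0..<n}, A) 2 l \<and> vertex_distinguishing ({0..<n}, A) l"
proof (intro exI conjI)
  let ?l = "\<lambda>u::nat. if u \<le> 1 then 2 else 1::nat"
  show "vertex_labelling ({0..<n}, A) 2 ?l"
    by (auto simp: vertex_labelling_def)
  have "\<phi> = id"
    if aut: "automorphism ({0..<n}, A) \<phi>" and l: "\<forall>u\<in>{0..<n}. ?l (\<phi> u) = ?l u" for \<phi>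
  proof -
    have 1: "nxt n 0 = 1" using n_ge_3 by (simp add: nxt_eq)
    \<comment> \<open>The vertices labelled 2 are exactly 0 and 1, so \<phi> fixes or swaps
      them.\<close>
    have "\<phi> 0 \<le> 1" "\<phi> 1 \<le> 1"
      using l[rule_format, of 0] l[rule_format, of 1] n_ge_3 by (auto split: if_splits)
    moreover have "\<phi> 0 \<noteq> \<phi> 1" using aut_eq_iff[OF aut] by simp
    moreover have "\<not> (\<phi> 0 = 1 \<and> \<phi> 1 = 0)"
      using not_swap[OF aut, of 0] n_ge_3 1 by auto
    ultimately have "\<phi> 0 = 0" "\<phi> 1 = 1" by linarith+
    then show ?thesis
      using rigid_nxt[OF aut, of 0] n_ge_3 1 by simp
  qed
  then show "vertex_distinguishing ({0..<n}, A) ?l"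
    unfolding vertex_distinguishing_def by blast
qed

text \<open>The \<open>i\<close> for which the arc lies on the edge \<open>{i, nxt n i}\<close>, so
  that arcs can be labelled without knowing their direction. For an arc against \<open>nxt\<close>
  the test fails because \<open>nxt n (nxt n i) \<noteq> i\<close>.\<close>

definition edge_index :: "nat \<times> nat \<Rightarrow> nat" where
  "edge_index a = (if snd a = nxt n (fst a) then fst a else snd a)"

lemma arc_edge_index:
  assumes "a \<in> A"
  shows "edge_index a < n"
    and "a = (edge_index a, nxt n (edge_index a)) \<or> a = (nxt n (edge_index a), edge_index a)"
proof -
  obtain u v where a: "a = (u, v)" by (cases a)
  with assms have "(u, v) \<in> A" by simp
  then have "edge_index a < n \<and>
    (a = (edge_index a, nxt n (edge_index a)) \<or> a = (nxt n (edge_index a), edge_index a))"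
    by (rule arc_cases) (auto simp: a edge_index_def nxt_nxt_neq[OF n_ge_3] nxt_less)
  then show "edge_index a < n"
    "a = (edge_index a, nxt n (edge_index a)) \<or> a = (nxt n (edge_index a), edge_index a)"
    by auto
qed

lemma edge_index_inj: "a \<in> A \<Longrightarrow> b \<in> A \<Longrightarrow> edge_index a = edge_index b \<Longrightarrow> a = b"
  using arc_edge_index(2)[of a] arc_edge_index(2)[of b] arc_asym by metis

lemma arc_with_index: "i < n \<Longrightarrow> \<exists>a\<in>A. edge_index a = i"
  using edge_oriented[of i] nxt_nxt_neq[OF n_ge_3, of i] by (force simp: edge_index_def)

text \<open>The only arc labelled \<open>c\<close> must be mapped to itself, direction included, so
  both its ends are fixed and \<open>rigid\<close> applies.\<close>

lemma arc_distinguishing_unique_label: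
  assumes "i < n" and unique: "\<And>a. a \<in> A \<Longrightarrow> l a = c \<longleftrightarrow> edge_index a = i"
  shows "arc_distinguishing ({0..<n}, A) l"
proof -
  obtain u v where uv: "(u, v) \<in> A" "edge_index (u, v) = i"
    using arc_with_index[OF assms(1)] by auto
  have "\<phi> = id"
    if aut: "automorphism ({0..<n}, A) \<phi>" and "\<forall>u v. (u, v) \<in> A \<longrightarrow> l (\<phi> u, \<phi> v) = l (u, v)"
    for \<phi>
  proof -
    have "(\<phi> u, \<phi> v) \<in> A" "l (\<phi> u, \<phi> v) = c"
      using aut_arc[OF aut] uv that(2) unique[of "(u, v)"] by auto
    then have "(\<phi> u, \<phi> v) = (u, v)"
      using uv unique edge_index_inj by metis
    then show ?thesis
      using rigid[OF aut uv(1)] by simp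
  qed
  then show ?thesis
    unfolding arc_distinguishing_def by blast
qed

lemma arc_labelling_2:
  "\<exists>l. arc_labelling ({0..<n}, A) 2 l \<and> arc_distinguishing ({0..<n}, A) l"
proof (intro exI conjI)
  let ?l = "\<lambda>a. if edge_index a = 0 then 2 else 1::nat"
  show "arc_labelling ({0..<n}, A) 2 ?l"
    by (auto simp: arc_labelling_def)
  show "arc_distinguishing ({0..<n}, A) ?l"
    by (rule arc_distinguishing_unique_label[of 0 _ 2]) (use n_ge_3 in auto)
qed

lemma arc_colouring_3:
  "\<exists>l. arc_colouring ({0..<n}, A) 3 l \<and> arc_distinguishing ({0..<n}, A) l"
proof (intro exI conjI)
  \<comment> \<open>Colour 3 is reserved for the edge between \<open>n - 1\<close> and 0; the other
    edges form a path, along which parity alternates for odd and even \<open>n\<close>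
    alike.\<close>
  let ?c = "\<lambda>i. if Suc i = n then 3 else if even i then 1 else 2::nat"
  let ?l = "\<lambda>a. ?c (edge_index a)"
  have c: "?c i \<noteq> ?c (nxt n i)" if "i < n" for i
    using that n_ge_3 by (auto simp: nxt_eq)
  have "?l a \<noteq> ?l b" if ab: "a \<in> A" "b \<in> A" "a \<noteq> b" "ends a \<inter> ends b \<noteq> {}" for a b
  proof -
    let ?i = "edge_index a" and ?j = "edge_index b"
    have "?i \<noteq> ?j" using edge_index_inj ab by blast
    moreover have ij: "?i < n" "?j < n" using arc_edge_index ab by auto
    moreover have "ends a = {?i, nxt n ?i}" "ends b = {?j, nxt n ?j}"
      using arc_edge_index(2)[OF ab(1)] arc_edge_index(2)[OF ab(2)]
      by (metis ends_def fst_conv snd_conv insert_commute)+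
    \<comment> \<open>Distinct edges that meet are consecutive: a common successor end is excluded
      by injectivity of \<open>nxt\<close>.\<close>
    ultimately consider "nxt n ?j = ?i" | "nxt n ?i = ?j"
      using ab(4) nxt_inj by auto
    then show ?thesis
    proof cases
      case 1
      show ?thesis using c[OF ij(2)] unfolding 1 by (rule not_sym)
    next
      case 2
      show ?thesis using c[OF ij(1)] unfolding 2 .
    qed
  qed
  then show "arc_colouring ({0..<n}, A) 3 ?l"
    unfolding arc_colouring_def arc_labelling_def by auto
  show "arc_distinguishing ({0..<n}, A) ?l"
    by (rule arc_distinguishing_unique_label[of "n - 1" _ 3]) (use n_ge_3 in auto)
qed

section \<open>Upper bounds: proper vertex colourings\<close>

lemma vertex_colouringI:
  assumes "\<And>u. u < n \<Longrightarrow> l u \<in> {1..r}" "\<And>u. u < n \<Longrightarrow> l u \<noteq> l (nxt n u)"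
  shows "vertex_colouring ({0..<n}, A) r l"
proof -
  have "l u \<noteq> l v" if "(u, v) \<in> A" for u v
    using that by (rule arc_cases) (use assms(2) in force)+
  then show ?thesis
    using assms(1) by (auto simp: vertex_colouring_def vertex_labelling_def)
qed

text \<open>Vertex 0 alone has colour 3 and is fixed. The remaining path has an even number of
  vertices, so its ends 1 and \<open>n - 1\<close> are coloured differently.\<close>

lemma vertex_colouring_3_odd:
  assumes "odd n"
  shows "\<exists>l. vertex_colouring ({0..<n}, A) 3 l \<and> vertex_distinguishing ({0..<n}, A) l"
proof (intro exI conjI)
  let ?l = "\<lambda>u::nat. if u = 0 then 3 else if even u then 1 else 2::nat"
  show "vertex_colouring ({0..<n}, A) 3 ?l"
    using n_ge_3 by (intro vertex_colouringI) (auto simp: nxt_eq)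
  have "\<phi> = id"
    if aut: "automorphism ({0..<n}, A) \<phi>" and l: "\<forall>u\<in>{0..<n}. ?l (\<phi> u) = ?l u" for \<phi>
  proof (rule rigid_0[OF aut])
    show "\<phi> 0 = 0"
      using l[rule_format, of 0] n_ge_3 by (auto split: if_splits)
    show "\<phi> 1 \<noteq> n - 1"
      using l[rule_format, of 1] n_ge_3 assms by (auto split: if_splits)
  qed
  then show "vertex_distinguishing ({0..<n}, A) ?l"
    unfolding vertex_distinguishing_def by blast
qed

text \<open>The vertex \<open>v\<close> alone has colour 3 and is fixed. Of its two neighbours only
  \<open>w\<close> is an out-neighbour, so \<open>w\<close> is fixed as well.\<close>

lemma vertex_colouring_3_through:
  assumes "even n" and uv: "(u, v) \<in> A" and vw: "(v, w) \<in> A"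
  shows "\<exists>l. vertex_colouring ({0..<n}, A) 3 l \<and> vertex_distinguishing ({0..<n}, A) l"
proof (intro exI conjI)
  let ?l = "\<lambda>x::nat. if x = v then 3 else if even x then 1 else 2::nat"
  show "vertex_colouring ({0..<n}, A) 3 ?l"
    using n_ge_3 \<open>even n\<close> by (intro vertex_colouringI) (auto simp: nxt_eq)
  have "\<phi> = id"
    if aut: "automorphism ({0..<n}, A) \<phi>" and l: "\<forall>u\<in>{0..<n}. ?l (\<phi> u) = ?l u" for \<phi>
  proof -
    have v: "\<phi> v = v"
      using l[rule_format, of v] arc_less[OF uv] by (auto split: if_splits)
    have \<phi>: "(v, \<phi> w) \<in> A"
      using aut_arc[OF aut vw] v by simp
    have "u \<noteq> w" using uv vw arc_asym by blast
    then have "\<phi> w = w"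
      using neighbours uv vw \<phi> arc_asym by blast
    then show ?thesis
      using rigid[OF aut vw] v by simp
  qed
  then show "vertex_distinguishing ({0..<n}, A) ?l"
    unfolding vertex_distinguishing_def by blast
qed

lemma vertex_colouring_3_alternating:
  assumes "even n" "6 \<le> n" and alternating: "\<And>u v w. (u, v) \<in> A \<Longrightarrow> (v, w) \<notin> A"
  shows "\<exists>l. vertex_colouring ({0..<n}, A) 3 l \<and> vertex_distinguishing ({0..<n}, A) l"
proof (intro exI conjI)
  \<comment> \<open>Vertices 1 and 2 go against the parity rule, so that the neighbours 1 and
    \<open>n - 1\<close> of 0 get different colours. The second vertex of colour 3 makes this
    proper.\<close>
  let ?l = "\<lambda>x::nat. if x = 0 \<or> x = 3 then 3 else if x = 1 then 1 else if x = 2 then 2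
    else if even x then 1 else 2::nat"
  show "vertex_colouring ({0..<n}, A) 3 ?l"
  proof (rule vertex_colouringI)
    show "?l u \<noteq> ?l (nxt n u)" if "u < n" for u
    proof -
      have 4: "?l x = (if even x then 1 else 2)" if "4 \<le> x" for x
        using that by simp
      consider "u = 0" | "u = 1" | "u = 2" | "u = 3" | "4 \<le> u" "Suc u = n" | "4 \<le> u" "Suc u \<noteq> n"
        by arith
      then show ?thesis
      proof cases
        case 5
        then have "odd u" using assms(1) by auto
        then show ?thesis using 5 4[of u] by (simp add: nxt_eq)
      next
        case 6
        then show ?thesis using 4[of u] 4[of "Suc u"] that by (simp add: nxt_eq)
      qed (use assms(2) in \<open>simp_all add: nxt_eq\<close>)
    qed
  qed auto
  have "\<phi> = id"
    if aut: "automorphism ({0..<n}, A) \<phi>" and l: "\<forall>u\<in>{0..<n}. ?l (\<phi> u) = ?l u" for \<phi>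
  proof (rule rigid_0[OF aut])
    have "nxt n 0 = 1" "nxt n 1 = 2" "nxt n 2 = 3"
      using \<open>6 \<le> n\<close> by (auto simp: nxt_eq)
    then have "(0, 1) \<in> A \<or> (1, 0) \<in> A" "(1, 2) \<in> A \<or> (2, 1) \<in> A" "(2, 3) \<in> A \<or> (3, 2) \<in> A"
      using edge_oriented[of 0] edge_oriented[of 1] edge_oriented[of 2] \<open>6 \<le> n\<close> by simp_all
    \<comment> \<open>Directions alternate along 0, 1, 2, 3, so one of 0 and 3 is a source and the
      other a sink. An automorphism sends tails to tails and heads to heads, hence cannot map 0 to
      3.\<close>
    then have "(0, 1) \<in> A \<and> (2, 3) \<in> A \<or> (1, 0) \<in> A \<and> (3, 2) \<in> A"
      using alternating by blast
    then have "(\<phi> 0, \<phi> 1) \<in> A \<and> (2, 3) \<in> A \<or> (\<phi> 1, \<phi> 0) \<in> A \<and> (3, 2) \<in> A"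
      using aut_arc[OF aut, of 0 1] aut_arc[OF aut, of 1 0] by blast
    then have "\<phi> 0 \<noteq> 3"
      using alternating by metis
    moreover have "\<phi> 0 = 0 \<or> \<phi> 0 = 3"
      using l[rule_format, of 0] \<open>6 \<le> n\<close> by (auto split: if_splits)
    ultimately show "\<phi> 0 = 0" by blast
    have label_1: "?l (\<phi> 1) = ?l 1"
      using \<open>6 \<le> n\<close> by (intro bspec[OF l]) simp
    have "?l (n - 1) \<noteq> ?l 1"
    proof -
      have "n - 1 \<notin> {0, 1, 2, 3}" "odd (n - 1)"
        using assms(1,2) by auto
      then show ?thesis by simp
    qed
    then show "\<phi> 1 \<noteq> n - 1"
      by (rule contrapos_nn) (use label_1 in \<open>simp only:\<close>)
  qed
  then show "vertex_distinguishing ({0..<n}, A) ?l"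
    unfolding vertex_distinguishing_def by blast
qed

lemma vertex_colouring_3:
  assumes "5 \<le> n"
  shows "\<exists>l. vertex_colouring ({0..<n}, A) 3 l \<and> vertex_distinguishing ({0..<n}, A) l"
proof (cases "odd n")
  case False
  then have "6 \<le> n" using assms by (cases "n = 5") auto
  \<comment> \<open>Either some vertex has both an incoming and an outgoing arc, or every vertex is
    a source or a sink.\<close>
  then show ?thesis
    using False vertex_colouring_3_through vertex_colouring_3_alternating by blast
qed (rule vertex_colouring_3_odd)

text \<open>All colours are distinct, \<open>Suc\<close> shifting the vertices into
  \<open>{1..n}\<close>. This supplies the upper bound for \<open>n = 4\<close>.\<close>

lemma vertex_colouring_order:
  "\<exists>l. vertex_colouring ({0..<n}, A) n l \<and> vertex_distinguishing ({0..<n}, A) l"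
proof (intro exI conjI)
  show "vertex_colouring ({0..<n}, A) n Suc"
    using n_ge_3 nxt_neq by (intro vertex_colouringI) (auto simp: Suc_le_eq dest: nxt_neq[rotated])
  show "vertex_distinguishing ({0..<n}, A) Suc"
    by (auto simp: vertex_distinguishing_def automorphism_def permutes_def fun_eq_iff)
qed

end

section \<open>Lower bounds from the directed cycle\<close>

definition directed_cycle :: "nat \<Rightarrow> (nat \<times> nat) set" where
  "directed_cycle n = {(i, nxt n i) | i. i < n}"

lemma directed_cycle_orientation:
  assumes "3 \<le> n"
  shows "({0..<n}, directed_cycle n) \<in> orientations (cycle_graph n)"
proof -
  \<comment> \<open>Distinct indices give distinct edges: the crossed case
    \<open>i = nxt n j\<close>, \<open>j = nxt n i\<close> would return to \<open>i\<close> after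
    two steps.\<close>
  have "i = j" if "i < n" "j < n" "{i, nxt n i} = {j, nxt n j}" for i j
    using that nxt_nxt_neq[OF assms] by (auto simp: doubleton_eq_iff)
  then show ?thesis
    by (auto simp: orientations_def edges_cycle_graph directed_cycle_def ends_def) metis
qed

text \<open>Rotation by two steps preserves constant labellings and proper 2-colourings alike, so
  one automorphism serves all four lower bounds.\<close>

lemma rotation_automorphism:
  "automorphism ({0..<n}, directed_cycle n) (\<lambda>i. nxt n (nxt n i))"
  using permutes_compose[OF nxt_permutes nxt_permutes, of n]
  by (auto simp: automorphism_def directed_cycle_def nxt_less comp_def)

lemma rotation_neq_id:
  assumes "3 \<le> n"
  shows "(\<lambda>i. nxt n (nxt n i)) \<noteq> id"
proof
  assume "(\<lambda>i. nxt n (nxt n i)) = id"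
  then have "nxt n (nxt n 0) = 0" by (metis id_apply)
  then show False using nxt_nxt_neq[of n 0] assms by simp
qed

lemma not_vertex_distinguishing_directed_cycle:
  assumes "3 \<le> n" "\<And>i. i < n \<Longrightarrow> l (nxt n (nxt n i)) = l i"
  shows "\<not> vertex_distinguishing ({0..<n}, directed_cycle n) l"
  using assms rotation_automorphism[of n] rotation_neq_id[of n]
  by (auto simp: vertex_distinguishing_def)

lemma not_arc_distinguishing_directed_cycle:
  assumes "3 \<le> n"
    "\<And>i. i < n \<Longrightarrow> l (nxt n (nxt n i), nxt n (nxt n (nxt n i))) = l (i, nxt n i)"
  shows "\<not> arc_distinguishing ({0..<n}, directed_cycle n) l"
proof -
  have "\<forall>u v. (u, v) \<in> directed_cycle n \<longrightarrow> l (nxt n (nxt n u), nxt n (nxt n v)) = l (u, v)"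
    using assms(2) by (auto simp: directed_cycle_def)
  then show ?thesis
    using rotation_automorphism[of n] rotation_neq_id[OF assms(1)]
    by (auto simp: arc_distinguishing_def)
qed

lemma directed_cycle_vertex_labelling_ge:
  assumes "3 \<le> n" "vertex_labelling ({0..<n}, directed_cycle n) r l"
    "vertex_distinguishing ({0..<n}, directed_cycle n) l"
  shows "2 \<le> r"
proof (rule ccontr)
  assume "\<not> 2 \<le> r"
  have "l i = 1" if "i < n" for i
  proof -
    have "l i \<in> {1..r}"
      using assms(2) that by (auto simp: vertex_labelling_def Pi_iff)
    with \<open>\<not> 2 \<le> r\<close> show ?thesis by auto
  qed
  then show False
    using not_vertex_distinguishing_directed_cycle[of n l] assms nxt_less by metis
qed

lemma directed_cycle_vertex_colouring_ge:
  assumes "3 \<le> n" "vertex_colouring ({0..<n}, directed_cycle n) r l"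
    "vertex_distinguishing ({0..<n}, directed_cycle n) l"
  shows "3 \<le> r"
proof (rule ccontr)
  assume "\<not> 3 \<le> r"
  have range: "l i = 1 \<or> l i = 2" if "i < n" for i
  proof -
    have "l i \<in> {1..r}"
      using assms(2) that by (auto simp: vertex_colouring_def vertex_labelling_def Pi_iff)
    with \<open>\<not> 3 \<le> r\<close> show ?thesis by auto
  qed
  have proper: "l i \<noteq> l (nxt n i)" if "i < n" for i
    using assms(2) that by (auto simp: vertex_colouring_def directed_cycle_def)
  \<comment> \<open>Both vertices differ in colour from the one between them, and only one other
    colour is left.\<close>
  have "l (nxt n (nxt n i)) = l i" if "i < n" for i
    using that range proper nxt_less by metis
  then show False
    using not_vertex_distinguishing_directed_cycle[of n l] assms by blast
qed

lemma directed_cycle_arc_labelling_ge: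
  assumes "3 \<le> n" "arc_labelling ({0..<n}, directed_cycle n) r l"
    "arc_distinguishing ({0..<n}, directed_cycle n) l"
  shows "2 \<le> r"
proof (rule ccontr)
  assume "\<not> 2 \<le> r"
  have "l (i, nxt n i) = 1" if "i < n" for i
  proof -
    have "l (i, nxt n i) \<in> {1..r}"
      using assms(2) that by (auto simp: arc_labelling_def directed_cycle_def Pi_iff)
    with \<open>\<not> 2 \<le> r\<close> show ?thesis by auto
  qed
  then show False
    using not_arc_distinguishing_directed_cycle[of n l] assms nxt_less by metis
qed

lemma directed_cycle_arc_colouring_ge:
  assumes "3 \<le> n" "arc_colouring ({0..<n}, directed_cycle n) r l"
    "arc_distinguishing ({0..<n}, directed_cycle n) l"
  shows "3 \<le> r"
proof (rule ccontr)
  assume "\<not> 3 \<le> r"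
  have range: "l (i, nxt n i) = 1 \<or> l (i, nxt n i) = 2" if "i < n" for i
  proof -
    have "l (i, nxt n i) \<in> {1..r}"
      using assms(2) that by (auto simp: arc_colouring_def arc_labelling_def directed_cycle_def Pi_iff)
    with \<open>\<not> 3 \<le> r\<close> show ?thesis by auto
  qed
  have proper: "l (i, nxt n i) \<noteq> l (nxt n i, nxt n (nxt n i))" if "i < n" for i
  proof -
    have "(i, nxt n i) \<in> directed_cycle n" "(nxt n i, nxt n (nxt n i)) \<in> directed_cycle n"
      using that nxt_less by (auto simp: directed_cycle_def)
    \<comment> \<open>This makes the two consecutive arcs distinct pairs, as the condition on arc
      colourings demands.\<close>
    moreover have "i \<noteq> nxt n i"
      using nxt_neq[of n i] that assms(1) by simp
    ultimately show ?thesis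
      using assms(2) by (auto simp: arc_colouring_def ends_def)
  qed
  have "l (nxt n (nxt n i), nxt n (nxt n (nxt n i))) = l (i, nxt n i)" if "i < n" for i
    using that range proper nxt_less by metis
  then show False
    using not_arc_distinguishing_directed_cycle[of n l] assms by blast
qed

section \<open>Lower bound for the cycle of order four\<close>

definition alternating_C4 :: "(nat \<times> nat) set" where
  "alternating_C4 = {(0, 1), (2, 1), (2, 3), (0, 3)}"

text \<open>An orientation amounts to \<open>ends\<close> being a bijection from arcs to edges.
  Surjectivity is computed; injectivity follows by counting four arcs and four edges.\<close>

lemma alternating_C4_orientation:
  "({0..<4}, alternating_C4) \<in> orientations (cycle_graph 4)"
proof -
  let ?E = "{{0, 1}, {1, 2}, {2, 3}, {3, 0::nat}}"
  have "{i::nat. i < 4} = {0, 1, 2, 3}"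
    by auto
  moreover have "Suc 0 mod 4 = 1" "Suc 1 mod 4 = 2" "Suc 2 mod 4 = 3" "Suc 3 mod 4 = 0"
    by simp_all
  ultimately have edges: "{{i, Suc i mod 4} | i. i < 4} = ?E"
    by (simp only: setcompr_eq_image image_insert image_empty)
  have image: "ends ` alternating_C4 = ?E"
  proof -
    have "ends (0, 1) = {0, 1::nat}" "ends (2, 1) = {1, 2::nat}"
      "ends (2, 3) = {2, 3::nat}" "ends (0, 3) = {3, 0::nat}"
      by (auto simp: ends_def)
    then show ?thesis
      by (simp only: alternating_C4_def image_insert image_empty)
  qed
  have inj: "inj_on ends alternating_C4"
  proof (rule eq_card_imp_inj_on)
    have "{0, 1::nat} \<noteq> {1, 2}" "{0, 1::nat} \<noteq> {2, 3}" "{0, 1::nat} \<noteq> {3, 0}"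
      "{1, 2::nat} \<noteq> {2, 3}" "{1, 2::nat} \<noteq> {3, 0}" "{2, 3::nat} \<noteq> {3, 0}"
      by (simp_all add: doubleton_eq_iff)
    then have "card ?E = 4"
      by (simp del: One_nat_def)
    moreover have "card alternating_C4 = 4"
      by (simp add: alternating_C4_def)
    ultimately show "card (ends ` alternating_C4) = card alternating_C4"
      by (simp only: image)
  qed (simp add: alternating_C4_def)
  have "\<forall>a\<in>alternating_C4. ends a \<in> ?E"
    unfolding image[symmetric] by blast
  moreover have "\<forall>e\<in>?E. \<exists>!a. a \<in> alternating_C4 \<and> ends a = e"
    unfolding image[symmetric] using inj by (auto dest: inj_onD)
  ultimately show ?thesis
    unfolding orientations_def cycle_graph_def edges by simp
qed

text \<open>The arcs are all pairs from \<open>{0, 2}\<close> to \<open>{1, 3}\<close>, so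
  transposing either of these sets is an automorphism. Opposite vertices thus differ in colour, and
  adjacent ones by properness.\<close>

lemma alternating_C4_vertex_colouring_ge:
  assumes "vertex_colouring ({0..<4}, alternating_C4) r l"
    "vertex_distinguishing ({0..<4}, alternating_C4) l"
  shows "4 \<le> r"
proof -
  have swap: "l a \<noteq> l b" if "(a, b) = (0, 2) \<or> (a, b) = (1, 3)" for a b
  proof
    assume eq: "l a = l b"
    have "a \<in> {0..<4}" "b \<in> {0..<4}" "a \<noteq> b"
      using that by auto
    moreover have "(transpose a b u, transpose a b v) \<in> alternating_C4"
      if "(u, v) \<in> alternating_C4" for u v
    proof -
      have "u \<in> {0, 2}" "v \<in> {1, 3}"
        using that by (auto simp: alternating_C4_def)
      then have "transpose a b u \<in> {0, 2}" "transpose a b v \<in> {1, 3}"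
        using \<open>(a, b) = (0, 2) \<or> (a, b) = (1, 3)\<close> by (auto simp: transpose_eq_iff)
      then show ?thesis unfolding alternating_C4_def by blast
    qed
    ultimately have "automorphism ({0..<4}, alternating_C4) (transpose a b)"
      by (simp add: automorphism_def permutes_swap_id)
    moreover have "\<forall>u\<in>{0..<4}. l (transpose a b u) = l u"
      using eq by (simp add: transpose_def)
    ultimately have "transpose a b = id"
      using assms(2) unfolding vertex_distinguishing_def by blast
    then show False
      using \<open>a \<noteq> b\<close> by (metis transpose_apply_first id_apply)
  qed
  have proper: "l u \<noteq> l v" if "(u, v) \<in> alternating_C4" for u v
    using assms(1) that unfolding vertex_colouring_def by simp
  have "l 0 \<noteq> l 1" "l 0 \<noteq> l 2" "l 0 \<noteq> l 3" "l 1 \<noteq> l 2" "l 1 \<noteq> l 3" "l 2 \<noteq> l 3"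
    using swap[of 0 2] swap[of 1 3] proper[of 0 1] proper[of 2 1] proper[of 2 3] proper[of 0 3]
    unfolding alternating_C4_def by fastforce+
  then have "inj_on l {0, 1, 2, 3}"
    by (simp add: inj_on_def)
  then have "card (l ` {0, 1, 2, 3}) = 4"
    by (simp add: card_image)
  moreover have "l ` {0, 1, 2, 3} \<subseteq> {1..r}"
    using assms(1) by (auto simp: vertex_colouring_def vertex_labelling_def)
  ultimately show ?thesis
    using card_mono[of "{1..r}" "l ` {0, 1, 2, 3}"] by simp
qed

section \<open>From bounds to maxima over all orientations\<close>

lemma Max_Least_eq:
  fixes P :: "'b \<Rightarrow> nat \<Rightarrow> bool"
  assumes "finite S" and upper: "\<And>x. x \<in> S \<Longrightarrow> P x k"
    and "x \<in> S" and lower: "\<And>r. P x r \<Longrightarrow> k \<le> r"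
  shows "Max ((\<lambda>x. LEAST r. P x r) ` S) = k"
proof (rule Max_eqI)
  show "y \<le> k" if "y \<in> (\<lambda>x. LEAST r. P x r) ` S" for y
    using that upper by (auto intro: Least_le)
  \<comment> \<open>The minimum at \<open>x\<close> is exactly \<open>k\<close>, so the bound on all
    minima is attained.\<close>
  have "(LEAST r. P x r) = k"
    using upper[OF \<open>x \<in> S\<close>] lower by (rule Least_equality)
  then show "k \<in> (\<lambda>x. LEAST r. P x r) ` S"
    using \<open>x \<in> S\<close> by blast
qed (use assms in simp)

text \<open>The upper bound comes from the facts proved for every \<open>oriented_cycle\<close>, the
  lower bound from a single extremal orientation \<open>B\<close>.\<close>

lemma Max_Least_cycle_eq:
  fixes P :: "nat ograph \<Rightarrow> nat \<Rightarrow> bool"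
  assumes "3 \<le> n"
    and "\<And>A. oriented_cycle n A \<Longrightarrow> P ({0..<n}, A) k"
    and "({0..<n}, B) \<in> orientations (cycle_graph n)"
    and "\<And>r. P ({0..<n}, B) r \<Longrightarrow> k \<le> r"
  shows "Max ((\<lambda>x. LEAST r. P x r) ` orientations (cycle_graph n)) = k"
proof (rule Max_Least_eq)
  show "finite (orientations (cycle_graph n))"
    by (simp add: finite_orientations simple_graph_cycle_graph assms(1))
  fix G assume G: "G \<in> orientations (cycle_graph n)"
  then obtain A where "G = ({0..<n}, A)"
    by (auto simp: orientations_def cycle_graph_def)
  then show "P G k"
    using assms(1,2) G by (simp add: oriented_cycle_def)
qed (use assms(3,4) in blast)+

theorem theorem7:
  "(\<forall>n\<ge>4. D_max (cycle_graph n) = 2 \<and> D'_max (cycle_graph n) = 2) \<and>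
   (chi_D_max (cycle_graph 4) = 4 \<and> (\<forall>n\<ge>5. chi_D_max (cycle_graph n) = 3)) \<and>
   (\<forall>n\<ge>4. chi'_D_max (cycle_graph n) = 3)"
proof (intro conjI allI impI)
  fix n :: nat assume "4 \<le> n"
  then have n: "3 \<le> n" by simp
  \<comment> \<open>The directed cycle is extremal for all three parameters in this case.\<close>
  note dir = directed_cycle_orientation[OF n]
  show "D_max (cycle_graph n) = 2"
    unfolding D_max_def dist_number_def[abs_def]
    by (rule Max_Least_cycle_eq[OF n _ dir])
       (use oriented_cycle.vertex_labelling_2 directed_cycle_vertex_labelling_ge[OF n] in blast)+
  show "D'_max (cycle_graph n) = 2"
    unfolding D'_max_def dist_index_def[abs_def]
    by (rule Max_Least_cycle_eq[OF n _ dir])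
       (use oriented_cycle.arc_labelling_2 directed_cycle_arc_labelling_ge[OF n] in blast)+
  show "chi'_D_max (cycle_graph n) = 3"
    unfolding chi'_D_max_def dist_chromatic_index_def[abs_def]
    by (rule Max_Least_cycle_eq[OF n _ dir])
       (use oriented_cycle.arc_colouring_3 directed_cycle_arc_colouring_ge[OF n] in blast)+
next
  show "chi_D_max (cycle_graph 4) = 4"
    \<comment> \<open>For \<open>n = 4\<close> the extremal orientation is the one in which sources
      and sinks alternate.\<close>
    unfolding chi_D_max_def dist_chromatic_number_def[abs_def]
    by (rule Max_Least_cycle_eq[OF _ _ alternating_C4_orientation])
       (use oriented_cycle.vertex_colouring_order alternating_C4_vertex_colouring_ge
        in \<open>simp, blast+\<close>)
next
  fix n :: nat assume "5 \<le> n"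
  then have n: "3 \<le> n" by simp
  show "chi_D_max (cycle_graph n) = 3"
    unfolding chi_D_max_def dist_chromatic_number_def[abs_def]
    by (rule Max_Least_cycle_eq[OF n _ directed_cycle_orientation[OF n]])
       (use oriented_cycle.vertex_colouring_3[OF _ \<open>5 \<le> n\<close>]
        directed_cycle_vertex_colouring_ge[OF n] in blast)+
qed

end
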